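(* Let $X$ be a complex Banach space, let $A : X \to X$ be a bounded linear operator, and let $M \subseteq X$ be a closed linear subspace that is invariant under $A$ (i.e. $A(M)\subseteq M$). Let $D$ be a connected component of the resolvent set $\rho(A)$. If $D \cap \sigma(A|_M) \neq \emptyset$, then $$D \subseteq \sigma(A|_M).$$
   Context: $A|_M : M \to M$ denotes the restriction of $A$ to the closed invariant subspace $M$, regarded as a bounded linear operator on the Banach space $M$; its spectrum $\sigma(A|_M)$ is taken in the algebra $B(M)$ of bounded linear operators on $M$. The resolvent set is $\rho(A)=\mathbb{C}\setminus\sigma(A)$, where $\sigma(A)$ is the spectrum of $A$ in $B(X)$. The component $D$ may be bounded (a "hole" in $\sigma(A)$) or unbounded. *)

theory Defs
  imports "HOL-Analysis.Analysis"
begin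

text \<open>The class \<^class>\<open>banach\<close> provides the underlying real Banach space; complex scalar
  multiplication is added as further structure extending the real one.\<close>

class complex_banach = banach +
  fixes scaleC :: "complex \<Rightarrow> 'a \<Rightarrow> 'a"  (infixr "*\<^sub>C" 75)
  assumes scaleC_add_right: "c *\<^sub>C (x + y) = c *\<^sub>C x + c *\<^sub>C y"
    and scaleC_add_left: "(c + d) *\<^sub>C x = c *\<^sub>C x + d *\<^sub>C x"
    and scaleC_scaleC: "c *\<^sub>C d *\<^sub>C x = (c * d) *\<^sub>C x"
    and scaleC_of_real: "complex_of_real r *\<^sub>C x = r *\<^sub>R x"
    and norm_scaleC: "norm (c *\<^sub>C x) = cmod c * norm x"

lemma vector_space_scaleC:
  "vector_space (scaleC :: complex \<Rightarrow> 'a::complex_banach \<Rightarrow> 'a)"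
proof
  fix x :: 'a
  show "1 *\<^sub>C x = x"
    using scaleC_of_real[of 1 x] by simp
qed (simp_all add: scaleC_add_right scaleC_add_left scaleC_scaleC)

instantiation complex :: complex_banach
begin

definition scaleC_complex :: "complex \<Rightarrow> complex \<Rightarrow> complex"
  where "scaleC_complex c x = c * x"

instance
  by standard (simp_all add: scaleC_complex_def algebra_simps norm_mult scaleR_conv_of_real)

end

definition csubspace :: "'a::complex_banach set \<Rightarrow> bool"
  where "csubspace M \<longleftrightarrow> module.subspace scaleC M"

text \<open>\<open>bounded_ops M\<close> is the algebra \<open>B(M)\<close> of a (closed) linear subspace \<open>M\<close>. Operators on \<open>M\<close> are
  represented by functions on the whole type whose values outside \<open>M\<close> are irrelevant; the algebra
  \<open>B(X)\<close> of the full space is \<open>bounded_ops UNIV\<close>.\<close>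

definition bounded_ops :: "'a::complex_banach set \<Rightarrow> ('a \<Rightarrow> 'a) set"
  where "bounded_ops M = {T. T \<in> M \<rightarrow> M \<and>
    (\<forall>x\<in>M. \<forall>y\<in>M. T (x + y) = T x + T y) \<and>
    (\<forall>c. \<forall>x\<in>M. T (c *\<^sub>C x) = c *\<^sub>C T x) \<and>
    (\<exists>K. \<forall>x\<in>M. norm (T x) \<le> K * norm x)}"

definition invertible_op :: "'a::complex_banach set \<Rightarrow> ('a \<Rightarrow> 'a) \<Rightarrow> bool"
  where "invertible_op M T \<longleftrightarrow>
    (\<exists>S\<in>bounded_ops M. \<forall>x\<in>M. S (T x) = x \<and> T (S x) = x)"

definition spectrum :: "'a::complex_banach set \<Rightarrow> ('a \<Rightarrow> 'a) \<Rightarrow> complex set"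
  where "spectrum M T = {z. \<not> invertible_op M (\<lambda>x. T x - z *\<^sub>C x)}"

definition resolvent_set :: "'a::complex_banach set \<Rightarrow> ('a \<Rightarrow> 'a) \<Rightarrow> complex set"
  where "resolvent_set M T = - spectrum M T"

lemma restrict_in_bounded_ops:
  assumes "A \<in> bounded_ops UNIV" "csubspace M" "A ` M \<subseteq> M"
  shows "restrict A M \<in> bounded_ops M"
proof -
  interpret vector_space "scaleC :: complex \<Rightarrow> 'a \<Rightarrow> 'a"
    by (rule vector_space_scaleC)
  show ?thesis
    using assms by (auto simp: bounded_ops_def csubspace_def subspace_add subspace_scale)
qed

end

theory Submission
  imports Defs
begin

text \<open>For \<open>z \<in> \<rho>(A)\<close> with resolvent \<open>R(z) = (A - z)\<^sup>-\<^sup>1\<close>, \<open>z\<close> lies outside \<open>\<sigma>(A|\<^sub>M)\<close> iff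
  \<open>R(z)\<close> leaves \<open>M\<close> invariant. The vector \<open>y = R(z) x\<close> is the fixed point of
  \<open>y \<mapsto> R(w) (x + (z - w) y)\<close>, which is a contraction when \<open>z\<close> is close to \<open>w\<close>; if \<open>R(w)\<close> preserves the
  closed set \<open>M\<close>, so does this map for \<open>x \<in> M\<close>, and hence \<open>y \<in> M\<close>. As the norm of the resolvent is
  locally bounded, invariance of \<open>M\<close> under \<open>R(z)\<close> is locally constant in \<open>z \<in> \<rho>(A)\<close>, so it is
  constant on components.\<close>

interpretation scaleC: vector_space "scaleC :: complex \<Rightarrow> 'a::complex_banach \<Rightarrow> 'a"
  by (rule vector_space_scaleC)

lemma bounded_ops_UNIV_iff:
  "T \<in> bounded_ops UNIV \<longleftrightarrow>
    (\<forall>x y. T (x + y) = T x + T y) \<and> (\<forall>c x. T (c *\<^sub>C x) = c *\<^sub>C T x) \<and>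
    (\<exists>K. \<forall>x. norm (T x) \<le> K * norm x)"
  by (simp add: bounded_ops_def)

lemma bounded_ops_UNIV_diff:
  assumes "T \<in> bounded_ops UNIV"
  shows "T (x - y) = T x - T y"
proof -
  have "T (x - y + y) = T (x - y) + T y"
    using assms unfolding bounded_ops_UNIV_iff by blast
  then show ?thesis by simp
qed

lemma bounded_ops_UNIV_pos_bound:
  assumes "T \<in> bounded_ops UNIV"
  obtains K where "K > 0" "\<And>x. norm (T x) \<le> K * norm x"
proof -
  obtain K where K: "\<And>x. norm (T x) \<le> K * norm x"
    using assms unfolding bounded_ops_UNIV_iff by blast
  \<comment> \<open>The bound \<open>K\<close> may be zero or negative; the maximum with 1 makes it
    safe to divide by later.\<close>
  have "norm (T x) \<le> max K 1 * norm x" for x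
    by (rule order_trans[OF K]) (simp add: mult_right_mono)
  then show ?thesis
    using that[of "max K 1"] by simp
qed

text \<open>An inverse on \<open>M\<close> must agree there with \<open>S\<close>: apply
  \<open>S\<close> to \<open>T (S' x) = x\<close>. Conversely, if \<open>S\<close> maps
  \<open>M\<close> into itself, it inherits linearity and its bound on \<open>M\<close> and serves
  as the inverse.\<close>

lemma invertible_op_restrict_iff:
  assumes S: "S \<in> bounded_ops UNIV" "\<And>x. S (T x) = x" "\<And>x. T (S x) = x"
    and T': "\<And>x. x \<in> M \<Longrightarrow> T' x = T x"
  shows "invertible_op M T' \<longleftrightarrow> S ` M \<subseteq> M"
proof
  assume "invertible_op M T'"
  then obtain S' where S': "S' \<in> M \<rightarrow> M" "\<And>x. x \<in> M \<Longrightarrow> T' (S' x) = x"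
    by (auto simp: invertible_op_def bounded_ops_def)
  have "S x \<in> M" if "x \<in> M" for x
  proof -
    have "S' x \<in> M" using S'(1) that by blast
    moreover from this have "S' x = S x"
      using S'(2)[OF that] T' S(2)[of "S' x"] by simp
    ultimately show ?thesis by simp
  qed
  then show "S ` M \<subseteq> M" by blast
next
  assume "S ` M \<subseteq> M"
  then have "S \<in> bounded_ops M" "\<forall>x\<in>M. S (T' x) = x \<and> T' (S x) = x"
    using S T' by (auto simp: bounded_ops_def)
  then show "invertible_op M T'"
    unfolding invertible_op_def by blast
qed

lemma resolvent_setE:
  assumes "z \<in> resolvent_set UNIV A"
  obtains S where "S \<in> bounded_ops UNIV"
    "\<And>x. S (A x - z *\<^sub>C x) = x" "\<And>x. A (S x) - z *\<^sub>C S x = x"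
  using assms by (auto simp: resolvent_set_def spectrum_def invertible_op_def)

lemma not_in_spectrum_restrict_iff:
  assumes "S \<in> bounded_ops UNIV"
    "\<And>x. S (A x - z *\<^sub>C x) = x" "\<And>x. A (S x) - z *\<^sub>C S x = x"
  shows "z \<notin> spectrum M (restrict A M) \<longleftrightarrow> S ` M \<subseteq> M"
  using invertible_op_restrict_iff[of S "\<lambda>x. A x - z *\<^sub>C x"] assms
  by (simp add: spectrum_def)

lemma mem_subspace_if_resolvent_invariant:
  fixes A :: "'a::complex_banach \<Rightarrow> 'a"
  assumes M: "csubspace M" "closed M"
    and S: "S \<in> bounded_ops UNIV" "\<And>x. S (A x - w *\<^sub>C x) = x" "S ` M \<subseteq> M"
    and K: "K > 0" "\<And>x. norm (S x) \<le> K * norm x" "cmod (z - w) * K < 1"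
    and y: "A y - z *\<^sub>C y \<in> M"
  shows "y \<in> M"
proof -
  define x where "x = A y - z *\<^sub>C y"
  define f where "f u = S (x + (z - w) *\<^sub>C u)" for u
  have contraction: "dist (f u) (f v) \<le> (cmod (z - w) * K) * dist u v" for u v
  proof -
    have "f u - f v = S ((z - w) *\<^sub>C (u - v))"
      by (simp add: f_def bounded_ops_UNIV_diff[OF S(1), symmetric] scaleC.scale_right_diff_distrib)
    then show ?thesis
      using K(2)[of "(z - w) *\<^sub>C (u - v)"] by (simp add: dist_norm norm_scaleC mult_ac)
  qed
  have fM: "f ` M \<subseteq> M"
    using M(1) y S(3) unfolding f_def x_def csubspace_def
    by (auto intro!: scaleC.subspace_add scaleC.subspace_scale)
  \<comment> \<open>Banach's theorem is applied inside \<open>M\<close>, which must be nonempty and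
    complete, so that the fixed point lies in \<open>M\<close>.\<close>
  have "0 \<in> M" using M(1) by (simp add: csubspace_def scaleC.subspace_0)
  then have "\<exists>!u\<in>M. f u = u"
    using M(2) K(1,3) fM contraction
    by (intro Banach_fix[of M "cmod (z - w) * K"]) (auto simp: complete_eq_closed)
  then obtain u where u: "u \<in> M" "f u = u" by blast
  have "x + (z - w) *\<^sub>C y = A y - w *\<^sub>C y"
    by (simp add: x_def scaleC.scale_left_diff_distrib)
  then have "f y = y" by (simp add: f_def S(2))
  \<comment> \<open>The contraction estimate holds on the whole space, so the fixed point
    \<open>y\<close>, not yet known to lie in \<open>M\<close>, must coincide with
    \<open>u\<close>.\<close>
  have "dist u y \<le> (cmod (z - w) * K) * dist u y"
    using contraction[of u y] \<open>f y = y\<close> u(2) by simp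
  then have "(1 - cmod (z - w) * K) * dist u y \<le> 0"
    by (simp add: algebra_simps)
  then have "u = y"
    using K(3) by (simp add: mult_le_0_iff)
  then show ?thesis using u(1) by simp
qed

text \<open>Writing \<open>(A - w) y = x + (z - w) y\<close> for \<open>y = S' x\<close> and
  applying \<open>S\<close> bounds \<open>norm y\<close> by \<open>K * norm x\<close> plus at most
  half of \<open>norm y\<close>, which is absorbed on the left.\<close>

lemma resolvent_norm_le:
  fixes A :: "'a::complex_banach \<Rightarrow> 'a"
  assumes S: "\<And>x. S (A x - w *\<^sub>C x) = x" "\<And>x. norm (S x) \<le> K * norm x"
    and S': "\<And>x. A (S' x) - z *\<^sub>C S' x = x"
    and K: "K > 0" "cmod (z - w) * K \<le> 1 / 2"
  shows "norm (S' x) \<le> 2 * K * norm x"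
proof -
  define y where "y = S' x"
  have "A y - w *\<^sub>C y = x + (z - w) *\<^sub>C y"
    using S'[of x] by (simp add: y_def scaleC.scale_left_diff_distrib algebra_simps)
  then have "norm y \<le> K * norm (x + (z - w) *\<^sub>C y)"
    using S(1)[of y] S(2)[of "A y - w *\<^sub>C y"] by simp
  also have "\<dots> \<le> K * (norm x + cmod (z - w) * norm y)"
    using K(1) norm_triangle_ineq[of x "(z - w) *\<^sub>C y"] by (simp add: norm_scaleC)
  also have "\<dots> = K * norm x + (cmod (z - w) * K) * norm y"
    by (simp add: algebra_simps)
  also have "\<dots> \<le> K * norm x + 1 / 2 * norm y"
    using K(2) by (intro add_left_mono mult_right_mono) auto
  finally show ?thesis by (simp add: y_def)
qed

lemma spectrum_restrict_locally_constant:
  fixes A :: "'a::complex_banach \<Rightarrow> 'a"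
  assumes M: "csubspace M" "closed M" and w: "w \<in> resolvent_set UNIV A"
  obtains e where "e > 0"
    "\<And>z. \<lbrakk>z \<in> resolvent_set UNIV A; dist z w < e\<rbrakk> \<Longrightarrow>
      z \<in> spectrum M (restrict A M) \<longleftrightarrow> w \<in> spectrum M (restrict A M)"
proof -
  obtain S where S: "S \<in> bounded_ops UNIV"
    "\<And>x. S (A x - w *\<^sub>C x) = x" "\<And>x. A (S x) - w *\<^sub>C S x = x"
    using resolvent_setE[OF w] by blast
  obtain K where K: "K > 0" "\<And>x. norm (S x) \<le> K * norm x"
    using bounded_ops_UNIV_pos_bound[OF S(1)] by blast
  show ?thesis
  \<comment> \<open>With this radius, \<open>cmod (z - w)\<close> times either resolvent bound,
    \<open>K\<close> at \<open>w\<close> or \<open>2 * K\<close> at \<open>z\<close>, is below 1, so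
    the contraction argument works in both directions.\<close>
  proof (rule that[of "1 / (2 * K)"])
    show "1 / (2 * K) > 0" using K(1) by simp
    fix z assume z: "z \<in> resolvent_set UNIV A" "dist z w < 1 / (2 * K)"
    then have small: "cmod (z - w) * K < 1 / 2"
      using K(1) by (simp add: dist_norm field_simps)
    obtain S' where S': "S' \<in> bounded_ops UNIV"
      "\<And>x. S' (A x - z *\<^sub>C x) = x" "\<And>x. A (S' x) - z *\<^sub>C S' x = x"
      using resolvent_setE[OF z(1)] by blast
    have K': "norm (S' x) \<le> (2 * K) * norm x" for x
      using resolvent_norm_le[OF S(2) K(2) S'(3) K(1)] small by simp
    have "S' x \<in> M" if "S ` M \<subseteq> M" "x \<in> M" for x
      using mem_subspace_if_resolvent_invariant[OF M S(1,2) that(1) K, of z "S' x"] small S'(3) that(2)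
      by simp
    \<comment> \<open>The roles of \<open>z\<close> and \<open>w\<close> are exchanged, with
      \<open>S'\<close> and its bound \<open>2 * K\<close> driving the contraction.\<close>
    moreover have "S x \<in> M" if "S' ` M \<subseteq> M" "x \<in> M" for x
      using mem_subspace_if_resolvent_invariant[OF M S'(1,2) that(1) _ K', of w "S x"]
        small K(1) S(3) that(2)
      by (simp add: norm_minus_commute)
    ultimately have "S' ` M \<subseteq> M \<longleftrightarrow> S ` M \<subseteq> M" by blast
    then show "z \<in> spectrum M (restrict A M) \<longleftrightarrow> w \<in> spectrum M (restrict A M)"
      using not_in_spectrum_restrict_iff[OF S] not_in_spectrum_restrict_iff[OF S'] by blast
  qed
qed

theorem theorem0p2:
  fixes A :: "'a::complex_banach \<Rightarrow> 'a" and M :: "'a set" and D :: "complex set"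
  assumes "A \<in> bounded_ops UNIV"
    and "csubspace M" and "closed M" and "A ` M \<subseteq> M"
    and "D \<in> components (resolvent_set UNIV A)"
    and "D \<inter> spectrum M (restrict A M) \<noteq> {}"
  shows "D \<subseteq> spectrum M (restrict A M)"
proof
  fix z assume z: "z \<in> D"
  obtain a where a: "a \<in> D" "a \<in> spectrum M (restrict A M)"
    using assms(6) by blast
  have D: "connected D" "D \<subseteq> resolvent_set UNIV A"
    using assms(5) by (auto dest: in_components_connected in_components_subset)
  show "z \<in> spectrum M (restrict A M)"
  \<comment> \<open>Connectedness reduces the claim to finding, around each \<open>w\<close> in
    \<open>D\<close>, a relatively open set on which membership in the spectrum passes between any
    two points; all points of a small ball agree with its centre.\<close>
  proof (rule connected_induction_simple[where P = "\<lambda>z. z \<in> spectrum M (restrict A M)", OF D(1) a(1) z a(2)])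
    fix w assume "w \<in> D"
    then obtain e where e: "e > 0"
      "\<And>z. \<lbrakk>z \<in> resolvent_set UNIV A; dist z w < e\<rbrakk> \<Longrightarrow>
        z \<in> spectrum M (restrict A M) \<longleftrightarrow> w \<in> spectrum M (restrict A M)"
      using spectrum_restrict_locally_constant[OF assms(2,3)] D(2) by (metis subsetD)
    have "openin (top_of_set D) (D \<inter> ball w e)"
      by (simp add: openin_open_Int)
    moreover have "x \<in> spectrum M (restrict A M) \<longleftrightarrow> w \<in> spectrum M (restrict A M)"
      if "x \<in> D \<inter> ball w e" for x
      using e(2)[of x] that D(2) by (auto simp: dist_commute)
    moreover have "w \<in> D \<inter> ball w e"
      using e(1) \<open>w \<in> D\<close> by simp
    ultimately show "\<exists>T. openin (top_of_set D) T \<and> w \<in> T \<and>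
      (\<forall>x\<in>T. \<forall>y\<in>T. x \<in> spectrum M (restrict A M) \<longrightarrow> y \<in> spectrum M (restrict A M))"
      by blast
  qed
qed

end
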